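(* (Skew-symmetry.) In an $N_W=N$ SUSY vertex algebra $V$ the following identity holds for all homogeneous $a,b\in V$: $$Y(a,Z)b=(-1)^{ab}\,e^{Z\nabla}\,Y(b,-Z)a .$$
   Context: Ground field $\mathbb C$; $N\ge0$ a fixed integer. In the exponent of $-1$, $a,b$ mean the parities. $Z=(z,\theta^1,\dots,\theta^N)$, $W=(w,\zeta^1,\dots,\zeta^N)$, $z,w$ even, $\theta^i,\zeta^i$ odd; odd variables anticommute with each other and supercommute with elements of superspaces; $[\ ,\ ]$ is the supercommutator. For $I=\{i_1<\dots<i_k\}\subset\{1,\dots,N\}$, $Z^{n|I}=z^n\theta^{i_1}\cdots\theta^{i_k}$. $-Z=(-z,-\theta^1,\dots,-\theta^N)$; $\nabla=(T,S^1,\dots,S^N)$ and $Z\nabla=zT+\sum_i\theta^iS^i$. An $N_W=N$ SUSY vertex algebra is a vector superspace $V$ with an even vector $|0\rangle$, an even operator $T$, odd operators $S^1,\dots,S^N$, and a parity preserving linear map $a\mapsto Y(a,Z)$ from $V$ to $\mathrm{End}(V)$-valued fields (formal sums $\sum_{n\in\mathbb Z,I}Z^{n|I}A_{n|I}$, $A_{n|I}\in\mathrm{End}(V)$, mapping each $v\in V$ into $V((z))[\theta^1,\dots,\theta^N]$) such that: $Y(a,Z)|0\rangle\in V[[z]][\theta^1,\dots,\theta^N]$ has value $a$ at $Z=0$, $T|0\rangle=S^i|0\rangle=0$; $[T,Y(a,Z)]=\partial_zY(a,Z)$, $[S^i,Y(a,Z)]=\partial_{\theta^i}Y(a,Z)$;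 for all $a,b$, $(z-w)^n[Y(a,Z),Y(b,W)]=0$ for some $n\ge0$. *)

theory Defs
  imports Complex_Main "HOL-Library.Groups_Big_Fun"
begin

text \<open>
  A vector superspace over the complex numbers is the whole type \<open>'v\<close>, with scalar
  multiplication \<open>scale\<close>, decomposed as the direct sum of \<open>V0\<close> (even) and \<open>V1\<close> (odd).
  Parities are natural numbers read modulo 2, so that they may be added and multiplied in
  exponents of \<open>-1\<close>.
\<close>

locale vector_superspace = vector_space scale
  for scale :: "complex \<Rightarrow> 'v::ab_group_add \<Rightarrow> 'v" +
  fixes V0 V1 :: "'v set"
  assumes subspace_even: "subspace V0"
    and subspace_odd: "subspace V1"
    and even_inter_odd: "V0 \<inter> V1 = {0}"
    and even_plus_odd: "\<And>v. \<exists>x\<in>V0. \<exists>y\<in>V1. v = x + y"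

definition parity_part :: "'v set \<Rightarrow> 'v set \<Rightarrow> nat \<Rightarrow> 'v set" where
  "parity_part V0 V1 p = (if even p then V0 else V1)"

definition parity_op ::
    "(complex \<Rightarrow> 'v::ab_group_add \<Rightarrow> 'v) \<Rightarrow> 'v set \<Rightarrow> 'v set \<Rightarrow> nat \<Rightarrow> ('v \<Rightarrow> 'v) \<Rightarrow> bool" where
  "parity_op scale V0 V1 p A \<longleftrightarrow> Vector_Spaces.linear scale scale A \<and>
     (\<forall>q. \<forall>x\<in>parity_part V0 V1 q. A x \<in> parity_part V0 V1 (p + q))"

text \<open>\<open>signed k x\<close> is $(-1)^k x$.\<close>

definition signed :: "'k::semiring_parity \<Rightarrow> 'v::ab_group_add \<Rightarrow> 'v" where
  "signed k x = (if even k then x else - x)"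

text \<open>
  A formal sum of the terms $Z^{n|I} v_{n|I}$ is encoded by its coefficients,
  \<open>F n I\<close> being $v_{n|I}$.  The coefficients always stand to the right of the monomials, and
  $\theta^{i_1}\cdots\theta^{i_k}$ is written with increasing indices.
\<close>

type_synonym 'a superseries = "int \<Rightarrow> nat set \<Rightarrow> 'a"

definition super_laurent :: "nat \<Rightarrow> 'v::zero superseries \<Rightarrow> bool" where
  "super_laurent N F \<longleftrightarrow> (\<forall>n I. \<not> I \<subseteq> {1..N} \<longrightarrow> F n I = 0) \<and> (\<exists>m. \<forall>n<m. \<forall>I. F n I = 0)"

definition super_taylor :: "nat \<Rightarrow> 'v::zero superseries \<Rightarrow> bool" where
  "super_taylor N F \<longleftrightarrow> (\<forall>n I. \<not> I \<subseteq> {1..N} \<longrightarrow> F n I = 0) \<and> (\<forall>n<0. \<forall>I. F n I = 0)"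

definition z_mult :: "'v superseries \<Rightarrow> 'v superseries" where
  "z_mult F = (\<lambda>n I. F (n - 1) I)"

definition z_deriv ::
    "(complex \<Rightarrow> 'v \<Rightarrow> 'v) \<Rightarrow> 'v superseries \<Rightarrow> 'v superseries" where
  "z_deriv scale F = (\<lambda>n I. scale (of_int (n + 1)) (F (n + 1) I))"

text \<open>
  Left multiplication by $\theta^i$ and the left derivative $\partial_{\theta^i}$; the sign
  comes from moving $\theta^i$ past the $\theta^j$ with $j < i$.
\<close>

definition theta_mult :: "nat \<Rightarrow> 'v::ab_group_add superseries \<Rightarrow> 'v superseries" where
  "theta_mult i F =
     (\<lambda>n I. if i \<in> I then signed (card {j\<in>I. j < i}) (F n (I - {i})) else 0)"

definition theta_deriv :: "nat \<Rightarrow> 'v::ab_group_add superseries \<Rightarrow> 'v superseries" where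
  "theta_deriv i F =
     (\<lambda>n I. if i \<in> I then 0 else signed (card {j\<in>I. j < i}) (F n (insert i I)))"

text \<open>
  Action of an operator \<open>A\<close> of parity \<open>p\<close>:
  $A\,Z^{n|I} v = (-1)^{p|I|} Z^{n|I} A v$.
\<close>

definition op_act :: "nat \<Rightarrow> ('v \<Rightarrow> 'v) \<Rightarrow> 'v::ab_group_add superseries \<Rightarrow> 'v superseries" where
  "op_act p A F = (\<lambda>n I. signed (p * card I) (A (F n I)))"

text \<open>The substitution of $-Z$ for $Z$.\<close>

definition neg_Z :: "'v::ab_group_add superseries \<Rightarrow> 'v superseries" where
  "neg_Z F = (\<lambda>n I. signed (n + int (card I)) (F n I))"

text \<open>The operator $Z\nabla = zT + \sum_i \theta^i S^i$ on series with coefficients in \<open>'v\<close>.\<close>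

definition Z_nabla :: "nat \<Rightarrow> ('v \<Rightarrow> 'v) \<Rightarrow> (nat \<Rightarrow> 'v \<Rightarrow> 'v) \<Rightarrow>
    'v::ab_group_add superseries \<Rightarrow> 'v superseries" where
  "Z_nabla N T S F = (\<lambda>n I. z_mult (op_act 0 T F) n I +
     (\<Sum>i=1..N. theta_mult i (op_act 1 (S i) F) n I))"

text \<open>
  $e^{Z\nabla} = \sum_k (Z\nabla)^k / k!$.  As $Z\nabla$ raises the total degree $n + |I|$ by
  one, only finitely many \<open>k\<close> contribute to a given coefficient when \<open>F\<close> satisfies
  \<^const>\<open>super_laurent\<close>; on other series \<^const>\<open>Sum_any\<close> may return the junk value 0.
\<close>

definition exp_Z_nabla :: "(complex \<Rightarrow> 'v \<Rightarrow> 'v) \<Rightarrow> nat \<Rightarrow> ('v \<Rightarrow> 'v) \<Rightarrow> (nat \<Rightarrow> 'v \<Rightarrow> 'v) \<Rightarrow>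
    'v::ab_group_add superseries \<Rightarrow> 'v superseries" where
  "exp_Z_nabla scale N T S F =
     (\<lambda>n I. Sum_any (\<lambda>k. scale (1 / fact k) ((Z_nabla N T S ^^ k) F n I)))"

text \<open>The value $A(Z)v$ of a series with operator coefficients.\<close>

definition field_apply :: "('v \<Rightarrow> 'v) superseries \<Rightarrow> 'v \<Rightarrow> 'v superseries" where
  "field_apply A v = (\<lambda>n I. A n I v)"

definition End_field ::
    "(complex \<Rightarrow> 'v::ab_group_add \<Rightarrow> 'v) \<Rightarrow> nat \<Rightarrow> ('v \<Rightarrow> 'v) superseries \<Rightarrow> bool" where
  "End_field scale N A \<longleftrightarrow> (\<forall>n I. Vector_Spaces.linear scale scale (A n I)) \<and>
     (\<forall>v. super_laurent N (field_apply A v))"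

text \<open>
  Since the $\theta^i$ are odd, $A(Z)$ has parity \<open>p\<close> if its coefficient $A_{n|I}$ has
  parity $p + |I|$.
\<close>

definition parity_field :: "(complex \<Rightarrow> 'v::ab_group_add \<Rightarrow> 'v) \<Rightarrow> 'v set \<Rightarrow> 'v set \<Rightarrow> nat \<Rightarrow> nat \<Rightarrow>
    ('v \<Rightarrow> 'v) superseries \<Rightarrow> bool" where
  "parity_field scale V0 V1 N p A \<longleftrightarrow>
     (\<forall>n I. I \<subseteq> {1..N} \<longrightarrow> parity_op scale V0 V1 (p + card I) (A n I))"

text \<open>
  The supercommutator $[X, A(Z)]$ of an operator \<open>X\<close> of parity \<open>p\<close> and a field $A(Z)$ of
  parity \<open>q\<close>, evaluated at a vector.
\<close>

definition op_bracket :: "nat \<Rightarrow> nat \<Rightarrow> ('v \<Rightarrow> 'v) \<Rightarrow> ('v \<Rightarrow> 'v) superseries \<Rightarrow>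
    'v \<Rightarrow> 'v::ab_group_add superseries" where
  "op_bracket p q X A v = (\<lambda>n I. op_act p X (field_apply A v) n I -
     signed (p * q) (field_apply A (X v) n I))"

text \<open>
  Two-variable series: \<open>F m I n J\<close> is the coefficient of $Z^{m|I} W^{n|J}$.  For fields
  $A(Z)$, $B(W)$ of parities \<open>p\<close>, \<open>q\<close>, the signs in the two products come from
  $A_{m|I} W^{n|J} = (-1)^{(p+|I|)|J|} W^{n|J} A_{m|I}$, and from moving $Z^{m|I}$ to the left
  of $B_{n|J}$ and then of $W^{n|J}$.
\<close>

type_synonym 'a superseries2 = "int \<Rightarrow> nat set \<Rightarrow> int \<Rightarrow> nat set \<Rightarrow> 'a"

definition product_ZW :: "nat \<Rightarrow> ('v \<Rightarrow> 'v) superseries \<Rightarrow> ('v \<Rightarrow> 'v) superseries \<Rightarrow>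
    'v \<Rightarrow> 'v::ab_group_add superseries2" where
  "product_ZW p A B v = (\<lambda>m I n J. signed ((p + card I) * card J) (A m I (B n J v)))"

definition product_WZ :: "nat \<Rightarrow> ('v \<Rightarrow> 'v) superseries \<Rightarrow> ('v \<Rightarrow> 'v) superseries \<Rightarrow>
    'v \<Rightarrow> 'v::ab_group_add superseries2" where
  "product_WZ q B A v =
     (\<lambda>m I n J. signed ((q + card J) * card I + card J * card I) (B n J (A m I v)))"

definition field_bracket :: "nat \<Rightarrow> nat \<Rightarrow> ('v \<Rightarrow> 'v) superseries \<Rightarrow> ('v \<Rightarrow> 'v) superseries \<Rightarrow>
    'v \<Rightarrow> 'v::ab_group_add superseries2" where
  "field_bracket p q A B v = (\<lambda>m I n J. product_ZW p A B v m I n J -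
     signed (p * q) (product_WZ q B A v m I n J))"

definition zw_mult :: "'v::ab_group_add superseries2 \<Rightarrow> 'v superseries2" where
  "zw_mult F = (\<lambda>m I n J. F (m - 1) I n J - F m I (n - 1) J)"

text \<open>
  An $N_W = N$ SUSY vertex algebra; \<open>Y a n I\<close> is the coefficient of $Z^{n|I}$ in $Y(a,Z)$.
  Identities whose signs involve parities are stated for homogeneous vectors, as usual; they
  extend to all vectors by linearity.  In \<open>locality\<close> the exponent does not depend on \<open>v\<close>:
  the identity is one between series with operator coefficients.
\<close>

locale NW_SUSY_vertex_algebra = vector_superspace scale V0 V1
  for scale :: "complex \<Rightarrow> 'v::ab_group_add \<Rightarrow> 'v" and V0 V1 :: "'v set" +
  fixes N :: nat
    and vac :: 'v
    and T :: "'v \<Rightarrow> 'v"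
    and S :: "nat \<Rightarrow> 'v \<Rightarrow> 'v"
    and Y :: "'v \<Rightarrow> ('v \<Rightarrow> 'v) superseries"
  assumes vac_even: "vac \<in> V0"
    and T_even: "parity_op scale V0 V1 0 T"
    and S_odd: "\<And>i. i \<in> {1..N} \<Longrightarrow> parity_op scale V0 V1 1 (S i)"
    and Y_linear: "\<And>n I v. Vector_Spaces.linear scale scale (\<lambda>a. Y a n I v)"
    and Y_field: "\<And>a. End_field scale N (Y a)"
    and Y_parity: "\<And>a p. a \<in> parity_part V0 V1 p \<Longrightarrow> parity_field scale V0 V1 N p (Y a)"
    and Y_vac: "\<And>a. super_taylor N (field_apply (Y a) vac)"
    and Y_vac_at_0: "\<And>a. field_apply (Y a) vac 0 {} = a"
    and T_vac: "T vac = 0"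
    and S_vac: "\<And>i. i \<in> {1..N} \<Longrightarrow> S i vac = 0"
    and T_bracket: "\<And>a p v. a \<in> parity_part V0 V1 p \<Longrightarrow>
      op_bracket 0 p T (Y a) v = z_deriv scale (field_apply (Y a) v)"
    and S_bracket: "\<And>a p i v. a \<in> parity_part V0 V1 p \<Longrightarrow> i \<in> {1..N} \<Longrightarrow>
      op_bracket 1 p (S i) (Y a) v = theta_deriv i (field_apply (Y a) v)"
    and locality: "\<And>a b p q. a \<in> parity_part V0 V1 p \<Longrightarrow> b \<in> parity_part V0 V1 q \<Longrightarrow>
      \<exists>k. \<forall>v. (zw_mult ^^ k) (field_bracket p q (Y a) (Y b) v) = (\<lambda>m I n J. 0)"

end

theory Submission
  imports Defs
begin

text \<open>
  By locality $H(Z,W) = (z-w)^k\, Y(a,Z)Y(b,W)|0\rangle =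
  (-1)^{ab}(z-w)^k\, Y(b,W)Y(a,Z)|0\rangle$ for some $k$.  The first expression is regular
  in $w$, the second in $z$, so $H$ is a Taylor series in both variables, with
  $H(Z,0) = z^k\, Y(a,Z)b$ and $H(0,-Z) = (-1)^{ab} z^k\, Y(b,-Z)a$.  Moreover
  $(\partial_Z + \partial_W) H = \nabla H$.  For every Taylor series $H$ with this property
  both $H(Z,0)$ and $e^{Z\nabla} H(0,-Z)$ satisfy
  $\partial_Z F_H = \nabla F_H - F_{\partial_W H}$ and have the constant term $H(0,0)$, whence
  they agree by induction on the total degree.  It remains to cancel $z^k$, which commutes
  with $e^{Z\nabla}$.
\<close>

section \<open>Superseries\<close>

text \<open>The textbook route rewrites Y(a,Z) e^{W nabla} b as e^{W nabla} Y(a,Z-W) b, which calls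
  for expansions of negative powers of z - w and for a substitution mixing two sets of odd
  variables. Comparing two solutions of one first-order system avoids both: the only substitution
  left is that of -Z for Z. The comparison ranges over all covariant Taylor series because its
  recursion replaces H by its W-derivatives, which need not come from a product of two fields. The
  recursion determines everything: a coefficient at n > 0 is recovered from the z-derivative after
  division by n, and one at n = 0 with I nonempty from a theta-derivative up to sign. That the
  exponential solves the system rests on T and the S^i supercommuting with each other. This is not
  among the axioms and is itself extracted from Y(a,Z)|0>.\<close>

lemma signed_zero [simp]: "signed k 0 = 0"
  by (simp add: signed_def)

lemma signed_add: "signed k (x + y) = signed k x + signed k y"
  by (simp add: signed_def)

lemma signed_diff: "signed k (x - y) = signed k x - signed k y"
  by (simp add: signed_def)

lemma signed_signed: "signed k (signed l x) = signed (k + l) x"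
  by (simp add: signed_def)

lemma signed_sum: "signed k (\<Sum>i\<in>A. f i) = (\<Sum>i\<in>A. signed k (f i))"
  by (simp add: signed_def sum_negf)

lemma (in vector_space) scale_signed: "scale c (signed k x) = signed k (scale c x)"
  by (simp add: signed_def)

lemma linear_signed:
  assumes "Vector_Spaces.linear scale scale A"
  shows "A (signed k x) = signed k (A x)"
proof -
  interpret Vector_Spaces.linear scale scale A by fact
  show ?thesis by (simp add: signed_def neg)
qed

section \<open>Sign rules for the odd variables\<close>

lemma card_below_insert:
  fixes i k :: nat
  assumes "i \<notin> I"
  shows "card {j \<in> insert i I. j < k} = card {j \<in> I. j < k} + (if i < k then 1 else 0)"
proof -
  have "{j \<in> insert i I. j < k} =
      (if i < k then insert i {j \<in> I. j < k} else {j \<in> I. j < k})"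
    by auto
  then show ?thesis using assms by simp
qed

lemma card_below_remove:
  fixes i k :: nat
  assumes "i \<in> I"
  shows "card {j \<in> I. j < k} = card {j \<in> I - {i}. j < k} + (if i < k then 1 else 0)"
  using card_below_insert[of i "I - {i}" k] assms by (simp add: insert_absorb)

text \<open>This is the Clifford relation. For different indices only \<open>i \<notin> I\<close>,
  \<open>j \<in> I\<close> contributes; removing \<open>j\<close> changes the count below
  \<open>i\<close> iff \<open>j < i\<close>, inserting \<open>i\<close> changes the count below
  \<open>j\<close> iff \<open>i < j\<close>, and exactly one of these happens, so the two orders
  have opposite signs.\<close>

lemma theta_deriv_theta_mult:
  "theta_deriv i (theta_mult j F) n I + theta_mult j (theta_deriv i F) n I =
    (if i = j then F n I else 0)"
proof (cases "i = j")
  case True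
  show ?thesis
  proof (cases "i \<in> I")
    case i: True
    then have "card {k \<in> I. k < i} = card {k \<in> I - {i}. k < i}"
      using card_below_remove[of i I i] by simp
    then show ?thesis
      using i True
      by (simp add: theta_deriv_def theta_mult_def signed_signed insert_absorb) (simp add: signed_def)
  next
    case i: False
    then have "card {k \<in> insert i I. k < i} = card {k \<in> I. k < i}"
      using card_below_insert[of i I i] by simp
    then show ?thesis
      using i True
      by (simp add: theta_deriv_def theta_mult_def signed_signed)
        (simp add: signed_def)
  qed
next
  case False
  show ?thesis
  proof (cases "i \<notin> I \<and> j \<in> I")
    case True
    define c where "c = card {k \<in> I - {j}. k < i}"
    define d where "d = card {k \<in> I. k < j}"
    have c: "card {k \<in> I. k < i} = c + (if j < i then 1 else 0)"
      unfolding c_def using True by (intro card_below_remove) simp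
    have d: "card {k \<in> insert i I. k < j} = d + (if i < j then 1 else 0)"
      unfolding d_def using True by (intro card_below_insert) simp
    have eq: "insert i I - {j} = insert i (I - {j})" using False by auto
    have "theta_deriv i (theta_mult j F) n I =
        signed (c + (if j < i then 1 else 0) + (d + (if i < j then 1 else 0)))
          (F n (insert i (I - {j})))"
      using True unfolding theta_deriv_def theta_mult_def c d eq by (simp add: signed_signed)
    moreover have "theta_mult j (theta_deriv i F) n I = signed (d + c) (F n (insert i (I - {j})))"
      using True False unfolding theta_deriv_def theta_mult_def c_def[symmetric] d_def[symmetric]
      by (simp add: signed_signed)
    ultimately show ?thesis using False by (simp add: signed_def)
  qed (use False in \<open>auto simp: theta_deriv_def theta_mult_def\<close>)
qed

lemma theta_deriv_signed:
  "theta_deriv i (\<lambda>n I. signed k (F n I)) n I = signed k (theta_deriv i F n I)"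
  by (simp add: theta_deriv_def signed_def)

text \<open>Inserting the smaller index raises the count below the larger one by one, and this
  affects just one of the two orders.\<close>

lemma theta_deriv_anticommute:
  "theta_deriv i (theta_deriv j F) n I = - theta_deriv j (theta_deriv i F) n I"
proof (cases "i \<notin> I \<and> j \<notin> I \<and> i \<noteq> j")
  case True
  then have *: "card {k \<in> insert i I. k < j} = card {k \<in> I. k < j} + (if i < j then 1 else 0)"
    "card {k \<in> insert j I. k < i} = card {k \<in> I. k < i} + (if j < i then 1 else 0)"
    by (intro card_below_insert, simp)+
  show ?thesis
    using True unfolding theta_deriv_def * by (simp add: signed_def insert_commute)
qed (auto simp: theta_deriv_def)

text \<open>The signs of \<open>op_act\<close> and \<open>neg_Z\<close> use \<open>card\<close>,
  which is 0 on infinite sets, so their sign rules are valid only for finite \<open>I\<close>.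
  Support in {1..N} makes the identities hold at every index.\<close>

definition supported :: "nat \<Rightarrow> 'v::zero superseries \<Rightarrow> bool" where
  "supported N F \<longleftrightarrow> (\<forall>n I. \<not> I \<subseteq> {1..N} \<longrightarrow> F n I = 0)"

lemma theta_mult_uminus: "theta_mult i (\<lambda>n I. - F n I) n I = - theta_mult i F n I"
  by (simp add: theta_mult_def signed_def)

lemma theta_mult_cong: "F n (I - {i}) = G n (I - {i}) \<Longrightarrow> theta_mult i F n I = theta_mult i G n I"
  by (simp add: theta_mult_def)

lemma super_taylor_supported: "super_taylor N F \<Longrightarrow> supported N F"
  by (simp add: super_taylor_def supported_def)

lemma super_taylor_neg_Z: "super_taylor N F \<Longrightarrow> super_taylor N (neg_Z F)"
  by (simp add: super_taylor_def neg_Z_def)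

lemma supported_theta_deriv: "supported N F \<Longrightarrow> supported N (theta_deriv i F)"
  by (simp add: supported_def theta_deriv_def)

section \<open>Powers of z - w and of z\<close>

lemma zw_mult_power_diff:
  "(zw_mult ^^ k) (\<lambda>m I n J. F m I n J - G m I n J) m I n J =
    (zw_mult ^^ k) F m I n J - (zw_mult ^^ k) G m I n J"
proof (induction k arbitrary: m I n J)
  case (Suc k)
  then have "(zw_mult ^^ k) (\<lambda>m I n J. F m I n J - G m I n J) =
      (\<lambda>m I n J. (zw_mult ^^ k) F m I n J - (zw_mult ^^ k) G m I n J)" by blast
  then have "(zw_mult ^^ Suc k) (\<lambda>m I n J. F m I n J - G m I n J) m I n J =
      zw_mult (\<lambda>m I n J. (zw_mult ^^ k) F m I n J - (zw_mult ^^ k) G m I n J) m I n J"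
    by simp
  also have "\<dots> = (zw_mult ^^ Suc k) F m I n J - (zw_mult ^^ Suc k) G m I n J"
    by (simp add: zw_mult_def)
  finally show ?case .
qed simp

lemma zw_mult_power_eq_0:
  assumes "\<And>m n. F m I n J = 0"
  shows "(zw_mult ^^ k) F m I n J = 0"
  by (induction k arbitrary: m n) (simp_all add: assms zw_mult_def)

text \<open>A series without negative powers of w may be evaluated at w = 0, where (z-w)^k becomes
  z^k; hence the shift by \<open>int k\<close>.\<close>

lemma zw_mult_power_w_taylor:
  assumes "\<And>m n. n < 0 \<Longrightarrow> F m I n J = 0"
  shows "n < 0 \<Longrightarrow> (zw_mult ^^ k) F m I n J = 0"
    and "(zw_mult ^^ k) F m I 0 J = F (m - int k) I 0 J"
proof -
  show *: "n < 0 \<Longrightarrow> (zw_mult ^^ k) F m I n J = 0" for k m n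
    by (induction k arbitrary: m n) (simp_all add: assms zw_mult_def)
  show "(zw_mult ^^ k) F m I 0 J = F (m - int k) I 0 J"
    by (induction k arbitrary: m) (simp_all add: zw_mult_def * algebra_simps)
qed

text \<open>The mirror image, except that (z-w)^k becomes (-w)^k at z = 0; hence the sign.\<close>

lemma zw_mult_power_z_taylor:
  assumes "\<And>m n. m < 0 \<Longrightarrow> F m I n J = 0"
  shows "m < 0 \<Longrightarrow> (zw_mult ^^ k) F m I n J = 0"
    and "(zw_mult ^^ k) F 0 I n J = signed k (F 0 I (n - int k) J)"
proof -
  show *: "m < 0 \<Longrightarrow> (zw_mult ^^ k) F m I n J = 0" for k m n
    by (induction k arbitrary: m n) (simp_all add: assms zw_mult_def)
  show "(zw_mult ^^ k) F 0 I n J = signed k (F 0 I (n - int k) J)"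
    by (induction k arbitrary: n) (simp_all add: zw_mult_def * algebra_simps signed_def)
qed

lemma z_mult_power: "(z_mult ^^ k) F n I = F (n - int k) I"
  by (induction k arbitrary: n) (simp_all add: z_mult_def algebra_simps)

section \<open>The operators $Z\nabla$ and $e^{Z\nabla}$\<close>

text \<open>Supercommuting T and S^i are all that the calculus of e^{Z nabla} requires: the
  commutators of Z nabla with the derivatives are then T and S^i, which commute with Z
  nabla.\<close>

locale nabla_operators = vector_space scale
  for scale :: "complex \<Rightarrow> 'v::ab_group_add \<Rightarrow> 'v" +
  fixes N :: nat and T :: "'v \<Rightarrow> 'v" and S :: "nat \<Rightarrow> 'v \<Rightarrow> 'v"
  assumes linear_T: "Vector_Spaces.linear scale scale T"
    and linear_S: "\<And>i. i \<in> {1..N} \<Longrightarrow> Vector_Spaces.linear scale scale (S i)"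
    and S_T: "\<And>i v. i \<in> {1..N} \<Longrightarrow> S i (T v) = T (S i v)"
    and S_anticommute:
      "\<And>i j v. i \<in> {1..N} \<Longrightarrow> j \<in> {1..N} \<Longrightarrow> S i (S j v) = - S j (S i v)"
begin

sublocale T: Vector_Spaces.linear scale scale T by (rule linear_T)

lemma
  assumes "i \<in> {1..N}"
  shows S_zero: "S i 0 = 0"
    and S_add: "S i (x + y) = S i x + S i y"
    and S_sum: "S i (sum f A) = (\<Sum>x\<in>A. S i (f x))"
    and S_scale: "S i (scale c x) = scale c (S i x)"
    and S_signed: "S i (signed k x) = signed k (S i x)"
proof -
  interpret S: Vector_Spaces.linear scale scale "S i" by (rule linear_S) fact
  show "S i 0 = 0" "S i (x + y) = S i x + S i y" "S i (sum f A) = (\<Sum>x\<in>A. S i (f x))"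
    "S i (scale c x) = scale c (S i x)"
    by (rule S.zero S.add S.sum S.scale)+
  show "S i (signed k x) = signed k (S i x)"
    by (rule linear_signed) (rule linear_S, fact)
qed

abbreviation "nab \<equiv> Z_nabla N T S"

lemma Z_nabla_apply:
  "nab F n I = T (F (n - 1) I) + (\<Sum>i=1..N. theta_mult i (op_act 1 (S i) F) n I)"
  by (simp add: Z_nabla_def z_mult_def op_act_def signed_def)

lemma supported_Z_nabla:
  assumes "supported N F"
  shows "supported N (nab F)"
  unfolding supported_def
proof (intro allI impI)
  fix n I assume I: "\<not> I \<subseteq> {1..N}"
  have "theta_mult i (op_act 1 (S i) F) n I = 0" if "i \<in> {1..N}" for i
  proof -
    have "\<not> I - {i} \<subseteq> {1..N}" using I that by auto
    then show ?thesis
      using assms S_zero[OF that]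
      by (simp add: theta_mult_def op_act_def supported_def)
  qed
  then show "nab F n I = 0"
    using assms I by (simp add: Z_nabla_apply supported_def T.zero)
qed

lemma supported_Z_nabla_power:
  "supported N F \<Longrightarrow> supported N ((nab ^^ k) F)"
  by (induction k) (simp_all add: supported_Z_nabla)

section \<open>Commutators of Z nabla with the derivatives, T and S^i\<close>

lemma z_deriv_Z_nabla:
  "z_deriv scale (nab F) n I = nab (z_deriv scale F) n I + T (F n I)"
proof -
  have "scale (of_int (n + 1)) (theta_mult i (op_act 1 (S i) F) (n + 1) I) =
      theta_mult i (op_act 1 (S i) (z_deriv scale F)) n I" if "i \<in> {1..N}" for i
    using S_scale[OF that]
    by (simp add: theta_mult_def op_act_def z_deriv_def scale_signed)
  then have "(\<Sum>i=1..N. scale (of_int (n + 1)) (theta_mult i (op_act 1 (S i) F) (n + 1) I)) =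
      (\<Sum>i=1..N. theta_mult i (op_act 1 (S i) (z_deriv scale F)) n I)"
    by (intro sum.cong) auto
  then have "z_deriv scale (nab F) n I = scale (of_int (n + 1)) (T (F n I)) +
      (\<Sum>i=1..N. theta_mult i (op_act 1 (S i) (z_deriv scale F)) n I)"
    by (simp only: z_deriv_def Z_nabla_apply scale_right_distrib scale_sum_right add_diff_cancel_right')
  moreover have "scale (of_int (n + 1)) (T (F n I)) = T (z_deriv scale F (n - 1) I) + T (F n I)"
    using scale_left_distrib[of "of_int n" 1] by (simp add: z_deriv_def T.scale)
  ultimately show ?thesis
    by (simp only: Z_nabla_apply ac_simps)
qed

lemma T_Z_nabla: "T (nab F n I) = nab (\<lambda>n I. T (F n I)) n I"
proof -
  have "T (theta_mult i (op_act 1 (S i) F) n I) =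
      theta_mult i (op_act 1 (S i) (\<lambda>n I. T (F n I))) n I" if "i \<in> {1..N}" for i
    using S_T[OF that] by (simp add: theta_mult_def op_act_def linear_signed[OF linear_T])
  then show ?thesis
    by (simp add: Z_nabla_apply T.add T.sum)
qed

text \<open>S^i anticommutes with theta^j and with S^j, hence commutes with their product. On
  coefficients the first sign is the difference of \<open>card I\<close> and
  \<open>card (I - {j})\<close>.\<close>

lemma op_act_S_theta_mult:
  assumes "finite I" "i \<in> {1..N}" "j \<in> {1..N}"
  shows "op_act 1 (S i) (theta_mult j (op_act 1 (S j) F)) n I =
    theta_mult j (op_act 1 (S j) (op_act 1 (S i) F)) n I"
proof (cases "j \<in> I")
  case True
  have "op_act 1 (S i) (theta_mult j (op_act 1 (S j) F)) n I =
      signed (card I + (card {k \<in> I. k < j} + card (I - {j}))) (S i (S j (F n (I - {j}))))"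
    using True assms by (simp add: op_act_def theta_mult_def S_signed signed_signed)
  moreover have "theta_mult j (op_act 1 (S j) (op_act 1 (S i) F)) n I =
      signed (card {k \<in> I. k < j} + (card (I - {j}) + card (I - {j}))) (S j (S i (F n (I - {j}))))"
    using True assms by (simp add: op_act_def theta_mult_def S_signed signed_signed)
  moreover have "card I = Suc (card (I - {j}))"
    using True assms by (intro card.remove)
  ultimately show ?thesis
    by (simp only: S_anticommute[OF assms(2,3)]) (simp add: signed_def)
next
  case False
  then show ?thesis
    using S_zero[OF assms(2)] by (simp add: op_act_def theta_mult_def)
qed

lemma op_act_S_Z_nabla:
  assumes "finite I" "i \<in> {1..N}"
  shows "op_act 1 (S i) (nab F) n I = nab (op_act 1 (S i) F) n I"
proof -
  have "op_act 1 (S i) (nab F) n I = signed (card I) (S i (T (F (n - 1) I))) +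
     (\<Sum>j=1..N. op_act 1 (S i) (theta_mult j (op_act 1 (S j) F)) n I)"
    by (simp add: op_act_def Z_nabla_apply S_add[OF assms(2)] S_sum[OF assms(2)] signed_add signed_sum)
  also have "\<dots> = signed (card I) (S i (T (F (n - 1) I))) +
     (\<Sum>j=1..N. theta_mult j (op_act 1 (S j) (op_act 1 (S i) F)) n I)"
    using op_act_S_theta_mult assms by (intro arg_cong2[where f = "(+)"] sum.cong) auto
  also have "\<dots> = nab (op_act 1 (S i) F) n I"
    using S_T[OF assms(2)] by (simp add: Z_nabla_apply op_act_def linear_signed[OF linear_T])
  finally show ?thesis .
qed

lemma theta_deriv_op_act:
  assumes "finite I" "j \<in> {1..N}"
  shows "theta_deriv i (op_act 1 (S j) F) n I = - op_act 1 (S j) (theta_deriv i F) n I"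
  using assms S_zero[OF assms(2)]
  by (simp add: theta_deriv_def op_act_def S_signed[OF assms(2)] card_insert_if)
    (simp add: signed_def)

text \<open>The derivative passes theta^j and then S^j, and the two minus signs cancel; the Clifford
  relation adds the extra term in the summand \<open>j = i\<close>.\<close>

lemma theta_deriv_Z_nabla:
  assumes "finite I" "i \<in> {1..N}"
  shows "theta_deriv i (nab F) n I = nab (theta_deriv i F) n I + op_act 1 (S i) F n I"
proof -
  have *: "theta_deriv i (theta_mult j (op_act 1 (S j) F)) n I =
      theta_mult j (op_act 1 (S j) (theta_deriv i F)) n I +
        (if j = i then op_act 1 (S i) F n I else 0)" if "j \<in> {1..N}" for j
  proof -
    have "theta_mult j (theta_deriv i (op_act 1 (S j) F)) n I =
        - theta_mult j (op_act 1 (S j) (theta_deriv i F)) n I"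
      unfolding theta_mult_uminus[symmetric]
      using theta_deriv_op_act[of "I - {j}" j i F n] assms that by (intro theta_mult_cong) simp
    then show ?thesis
      using theta_deriv_theta_mult[of i j "op_act 1 (S j) F" n I] by (auto simp: algebra_simps)
  qed
  have "theta_deriv i (nab F) n I = T (theta_deriv i F (n - 1) I) +
      (\<Sum>j=1..N. theta_deriv i (theta_mult j (op_act 1 (S j) F)) n I)"
    by (simp add: theta_deriv_def Z_nabla_apply signed_add signed_sum
        linear_signed[OF linear_T])
  also have "(\<Sum>j=1..N. theta_deriv i (theta_mult j (op_act 1 (S j) F)) n I) =
      (\<Sum>j=1..N. theta_mult j (op_act 1 (S j) (theta_deriv i F)) n I +
        (if j = i then op_act 1 (S i) F n I else 0))"
    using * by (intro sum.cong) auto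
  also have "\<dots> = (\<Sum>j=1..N. theta_mult j (op_act 1 (S j) (theta_deriv i F)) n I) +
      op_act 1 (S i) F n I"
    using assms(2) by (simp add: sum.distrib)
  finally show ?thesis
    unfolding Z_nabla_apply[of "theta_deriv i F"] by (simp only: add.assoc)
qed

lemma theta_mult_linear_combination:
  "theta_mult i (\<lambda>n I. F n I + scale c (G n I)) n I =
    theta_mult i F n I + scale c (theta_mult i G n I)"
  by (simp add: theta_mult_def signed_add scale_signed)

lemma Z_nabla_linear_combination:
  "nab (\<lambda>n I. F n I + scale c (G n I)) n I = nab F n I + scale c (nab G n I)"
proof -
  have "theta_mult i (op_act 1 (S i) (\<lambda>n I. F n I + scale c (G n I))) n I =
      theta_mult i (op_act 1 (S i) F) n I + scale c (theta_mult i (op_act 1 (S i) G) n I)"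
    if "i \<in> {1..N}" for i
    using that
    by (simp add: op_act_def S_add S_scale signed_add scale_signed theta_mult_linear_combination
        flip: scale_signed)
  then have "(\<Sum>i=1..N. theta_mult i (op_act 1 (S i) (\<lambda>n I. F n I + scale c (G n I))) n I) =
      (\<Sum>i=1..N. theta_mult i (op_act 1 (S i) F) n I + scale c (theta_mult i (op_act 1 (S i) G) n I))"
    by (intro sum.cong) auto
  then show ?thesis
    unfolding Z_nabla_apply
    by (simp add: T.add T.scale sum.distrib scale_right_distrib scale_sum_right algebra_simps)
qed

lemma Z_nabla_power_signed:
  "(nab ^^ k) (\<lambda>n I. signed l (F n I)) n I = signed l ((nab ^^ k) F n I)"
proof (induction k arbitrary: n I)
  case (Suc k)
  have "theta_mult i (op_act 1 (S i) (\<lambda>n I. signed l (G n I))) n I =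
      signed l (theta_mult i (op_act 1 (S i) G) n I)" if "i \<in> {1..N}" for G i
    using that by (simp add: theta_mult_def op_act_def S_signed) (simp add: signed_def)
  then have "(\<Sum>i=1..N. theta_mult i (op_act 1 (S i) (\<lambda>n I. signed l (G n I))) n I) =
      (\<Sum>i=1..N. signed l (theta_mult i (op_act 1 (S i) G) n I))" for G
    by (intro sum.cong) auto
  then have "nab (\<lambda>n I. signed l (G n I)) n I = signed l (nab G n I)" for G
    by (simp only: Z_nabla_apply linear_signed[OF linear_T] signed_add signed_sum)
  moreover have "(nab ^^ k) (\<lambda>n I. signed l (F n I)) = (\<lambda>n I. signed l ((nab ^^ k) F n I))"
    using Suc by blast
  ultimately show ?case by simp
qed simp

text \<open>If C = [X, A] commutes with A, then [X, A^k] = k C A^(k-1). Keeping \<open>X\<close> and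
  \<open>C\<close> abstract lets one induction serve both the z-derivative with C = T and the
  theta-derivatives with C = S^i.\<close>

lemma commutator_Z_nabla_power:
  assumes F: "supported N F"
    and X: "\<And>G. supported N G \<Longrightarrow> X (nab G) = (\<lambda>n I. nab (X G) n I + C G n I)"
    and C: "\<And>G. supported N G \<Longrightarrow> C (nab G) = nab (C G)"
  shows "X ((nab ^^ k) F) = (\<lambda>n I. (nab ^^ k) (X F) n I + scale (of_nat k) (C ((nab ^^ (k - 1)) F) n I))"
proof (induction k)
  case (Suc k)
  have G: "supported N ((nab ^^ j) F)" for j
    by (rule supported_Z_nabla_power) (rule F)
  have "X ((nab ^^ Suc k) F) = (\<lambda>n I. nab (X ((nab ^^ k) F)) n I + C ((nab ^^ k) F) n I)"
    using X[OF G] by simp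
  also have "\<dots> = (\<lambda>n I. (nab ^^ Suc k) (X F) n I +
      scale (of_nat k) (nab (C ((nab ^^ (k - 1)) F)) n I) + C ((nab ^^ k) F) n I)"
    unfolding Suc Z_nabla_linear_combination by simp
  moreover have "scale (of_nat k) (nab (C ((nab ^^ (k - 1)) F)) n I) + C ((nab ^^ k) F) n I =
      scale (of_nat (Suc k)) (C ((nab ^^ k) F) n I)" for n I
  \<comment> \<open>For \<open>k = 0\<close> the truncated \<open>k - 1\<close> does no harm, its
    term having the factor 0.\<close>
  proof (cases k)
    case (Suc j)
    then have "nab (C ((nab ^^ (k - 1)) F)) = C ((nab ^^ k) F)"
      using C[OF G, of j] by simp
    then show ?thesis
      by (simp only: of_nat_Suc scale_left_distrib scale_one add.commute)
  qed simp
  then have "(\<lambda>n I. (nab ^^ Suc k) (X F) n I +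
      scale (of_nat k) (nab (C ((nab ^^ (k - 1)) F)) n I) + C ((nab ^^ k) F) n I) =
      (\<lambda>n I. (nab ^^ Suc k) (X F) n I + scale (of_nat (Suc k)) (C ((nab ^^ k) F) n I))"
    by (simp only: add.assoc)
  ultimately show ?case by simp
qed simp

lemma super_taylor_Z_nabla_power:
  assumes "super_taylor N F"
  shows "super_taylor N ((nab ^^ k) F)"
proof (induction k)
  case (Suc k)
  define G where "G = (nab ^^ k) F"
  have G: "super_taylor N G" using Suc by (simp add: G_def)
  have "nab G n I = 0" if "n < 0" for n I
  proof -
    have "theta_mult i (op_act 1 (S i) G) n I = 0" if "i \<in> {1..N}" for i
      using G \<open>n < 0\<close> S_zero[OF that] by (simp add: theta_mult_def op_act_def super_taylor_def)
    then show ?thesis using G \<open>n < 0\<close> by (simp add: Z_nabla_apply super_taylor_def T.zero)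
  qed
  then show ?case
    using supported_Z_nabla[OF super_taylor_supported[OF G]]
    by (simp add: super_taylor_def supported_def flip: G_def)
qed (use assms in simp)

lemma Z_nabla_power_eq_0:
  assumes "super_taylor N F" "n + int (card I) < int k"
  shows "(nab ^^ k) F n I = 0"
  using assms(2)
proof (induction k arbitrary: n I)
  case 0
  then show ?case using assms(1) by (simp add: super_taylor_def)
next
  case (Suc k)
  define G where "G = (nab ^^ k) F"
  show ?case
  proof (cases "I \<subseteq> {1..N}")
    case True
    then have "finite I" by (rule finite_subset) simp
    have "theta_mult i (op_act 1 (S i) G) n I = 0" if "i \<in> {1..N}" for i
    proof (cases "i \<in> I")
      case True
      then have "card I = Suc (card (I - {i}))"
        using \<open>finite I\<close> by (intro card.remove)
      then have "G n (I - {i}) = 0" unfolding G_def using Suc.prems by (intro Suc.IH) linarith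
      then show ?thesis using S_zero[OF that] by (simp add: theta_mult_def op_act_def)
    qed (simp add: theta_mult_def)
    moreover have "G (n - 1) I = 0"
      unfolding G_def using Suc.prems by (intro Suc.IH) linarith
    ultimately have "nab G n I = 0" by (simp add: Z_nabla_apply T.zero)
    then show ?thesis by (simp add: G_def)
  next
    case False
    then show ?thesis
      using super_taylor_Z_nabla_power[OF assms(1), of "Suc k"] by (auto simp: super_taylor_def)
  qed
qed

section \<open>The exponential and its derivatives\<close>

abbreviation "expn \<equiv> exp_Z_nabla scale N T S"

text \<open>A monomial of exponent \<open>n\<close> has total degree at most
  \<open>n + int N\<close>. Bounding by \<open>N\<close> instead of \<open>card I\<close> gives one
  cutoff for all \<open>I\<close>, so the theta-derivative can be taken inside the sum although it
  moves from \<open>I\<close> to \<open>insert i I\<close>.\<close>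

lemma exp_Z_nabla_eq_sum:
  assumes "super_taylor N F" "n + int N \<le> int M"
  shows "expn F n I = (\<Sum>k\<le>M. scale (1 / fact k) ((nab ^^ k) F n I))"
proof -
  have "(nab ^^ k) F n I = 0" if "k > M" for k
  proof (cases "I \<subseteq> {1..N}")
    case True
    then have "card I \<le> N" using card_mono[of "{1..N}" I] by simp
    then show ?thesis using assms that by (intro Z_nabla_power_eq_0) auto
  next
    case False
    then show ?thesis
      using super_taylor_Z_nabla_power[OF assms(1), of k] by (auto simp: super_taylor_def)
  qed
  then show ?thesis
    unfolding exp_Z_nabla_def by (intro Sum_any.expand_superset) (auto intro: leI)
qed

lemma super_taylor_exp_Z_nabla:
  assumes "super_taylor N F"
  shows "super_taylor N (expn F)"
  using super_taylor_Z_nabla_power[OF assms] by (simp add: super_taylor_def exp_Z_nabla_def)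

lemma exp_Z_nabla_at_0:
  assumes "super_taylor N F"
  shows "expn F 0 {} = F 0 {}"
proof -
  have "expn F 0 {} = (\<Sum>k\<le>N. scale (1 / fact k) ((nab ^^ k) F 0 {}))"
    using assms by (intro exp_Z_nabla_eq_sum) auto
  also have "\<dots> = (\<Sum>k\<in>{0}. scale (1 / fact k) ((nab ^^ k) F 0 {}))"
    using Z_nabla_power_eq_0[OF assms, of 0 "{}"] by (intro sum.mono_neutral_right) auto
  finally show ?thesis by simp
qed

lemma exp_Z_nabla_signed:
  assumes "super_taylor N F"
  shows "expn (\<lambda>n I. signed l (F n I)) n I = signed l (expn F n I)"
proof -
  define M where "M = nat n + N"
  have M: "n + int N \<le> int M"
    unfolding M_def by linarith
  have F': "super_taylor N (\<lambda>n I. signed l (F n I))"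
    using assms by (simp add: super_taylor_def)
  show ?thesis
    unfolding exp_Z_nabla_eq_sum[OF assms M] exp_Z_nabla_eq_sum[OF F' M]
      Z_nabla_power_signed scale_signed signed_sum ..
qed

text \<open>Each power of Z nabla commutes with z, so the summed families agree term by term and no
  cutoff enters. Thus the lemma covers Laurent series such as Y(b,-Z)a, for which z^k is cancelled
  at the end.\<close>

lemma exp_Z_nabla_z_mult:
  "expn (z_mult F) = z_mult (expn F)"
proof -
  have "(nab ^^ k) (z_mult F) = z_mult ((nab ^^ k) F)" for k
  proof (induction k)
    case (Suc k)
    then show ?case
      by (simp add: Z_nabla_def[abs_def] z_mult_def op_act_def theta_mult_def cong: if_cong)
  qed simp
  then show ?thesis
    unfolding exp_Z_nabla_def by (simp add: z_mult_def)
qed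

text \<open>Since k / k! = 1 / (k-1)!, the commutator terms reassemble into an exponential sum that
  stops one step earlier.\<close>

lemma exp_sum_commutator:
  assumes "supported N F"
    and "\<And>G. supported N G \<Longrightarrow> X (nab G) = (\<lambda>n I. nab (X G) n I + C G n I)"
    and "\<And>G. supported N G \<Longrightarrow> C (nab G) = nab (C G)"
  shows "(\<Sum>k\<le>Suc M. scale (1 / fact k) (X ((nab ^^ k) F) n I)) =
    (\<Sum>k\<le>Suc M. scale (1 / fact k) ((nab ^^ k) (X F) n I)) +
    (\<Sum>k\<le>M. scale (1 / fact k) (C ((nab ^^ k) F) n I))"
proof -
  have "(\<Sum>k\<le>Suc M. scale (1 / fact k) (scale (of_nat k) (C ((nab ^^ (k - 1)) F) n I))) =
      (\<Sum>k\<le>M. scale (1 / fact k) (C ((nab ^^ k) F) n I))"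
    unfolding sum.atMost_Suc_shift by (simp del: of_nat_Suc add: fact_Suc)
  moreover have "X ((nab ^^ k) F) n I =
      (nab ^^ k) (X F) n I + scale (of_nat k) (C ((nab ^^ (k - 1)) F) n I)" for k
    using commutator_Z_nabla_power[of F X C k] assms by simp
  ultimately show ?thesis
    by (simp only: scale_right_distrib sum.distrib)
qed

lemma super_taylor_z_deriv:
  assumes "super_taylor N F"
  shows "super_taylor N (z_deriv scale F)"
proof -
  \<comment> \<open>At \<open>n = -1\<close> the coefficient \<open>F 0 I\<close> may be nonzero,
    but its factor is 0.\<close>
  have "scale (of_int (n + 1)) (F (n + 1) I) = 0" if "n < 0" for n I
    using assms that by (cases "n = -1") (auto simp: super_taylor_def)
  then show ?thesis
    using assms by (simp add: super_taylor_def z_deriv_def)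
qed

lemma z_deriv_exp_Z_nabla:
  assumes "super_taylor N F"
  shows "z_deriv scale (expn F) n I = expn (z_deriv scale F) n I + T (expn F n I)"
proof -
  \<comment> \<open>The left side reads coefficients at \<open>n + 1\<close> and needs the cutoff
    \<open>Suc M\<close>; the commutator sum ends at \<open>M\<close>, which suffices for
    \<open>n\<close>.\<close>
  define M where "M = nat n + N"
  have M: "n + int N \<le> int M" "n + int N \<le> int (Suc M)" "n + 1 + int N \<le> int (Suc M)"
    unfolding M_def by linarith+
  have F': "super_taylor N (z_deriv scale F)"
    by (rule super_taylor_z_deriv) fact
  have "z_deriv scale (expn F) n I =
      (\<Sum>k\<le>Suc M. scale (1 / fact k) (z_deriv scale ((nab ^^ k) F) n I))"
    unfolding z_deriv_def exp_Z_nabla_eq_sum[OF assms M(3)] scale_sum_right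
    by (simp add: mult.commute)
  also have "\<dots> = (\<Sum>k\<le>Suc M. scale (1 / fact k) ((nab ^^ k) (z_deriv scale F) n I)) +
      (\<Sum>k\<le>M. scale (1 / fact k) (T ((nab ^^ k) F n I)))"
    using super_taylor_supported[OF assms]
    by (intro exp_sum_commutator[where C = "\<lambda>G n I. T (G n I)"])
      (simp_all add: z_deriv_Z_nabla T_Z_nabla fun_eq_iff)
  finally show ?thesis
    unfolding exp_Z_nabla_eq_sum[OF assms M(1)] exp_Z_nabla_eq_sum[OF F' M(2)] T.sum T.scale .
qed

lemma supported_op_act_S:
  "supported N F \<Longrightarrow> i \<in> {1..N} \<Longrightarrow> supported N (op_act 1 (S i) F)"
  by (simp add: supported_def op_act_def S_zero)

lemma theta_deriv_exp_Z_nabla: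
  assumes "super_taylor N F" "i \<in> {1..N}"
  shows "theta_deriv i (expn F) n I =
    expn (theta_deriv i F) n I + op_act 1 (S i) (expn F) n I"
proof -
  define M where "M = nat n + N"
  have M: "n + int N \<le> int M" "n + int N \<le> int (Suc M)"
    unfolding M_def by linarith+
  have F': "super_taylor N (theta_deriv i F)"
    using assms unfolding super_taylor_def theta_deriv_def by simp
  have comm: "theta_deriv i (nab G) = (\<lambda>n I. nab (theta_deriv i G) n I + op_act 1 (S i) G n I)"
    "op_act 1 (S i) (nab G) = nab (op_act 1 (S i) G)" if G: "supported N G" for G
  proof -
    show "theta_deriv i (nab G) = (\<lambda>n I. nab (theta_deriv i G) n I + op_act 1 (S i) G n I)"
    proof (intro ext)
      fix n I
      show "theta_deriv i (nab G) n I = nab (theta_deriv i G) n I + op_act 1 (S i) G n I"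
      proof (cases "I \<subseteq> {1..N}")
        case True
        then show ?thesis using assms(2) by (intro theta_deriv_Z_nabla) (auto intro: finite_subset)
      next
        case False
        then show ?thesis
          using supported_theta_deriv[OF supported_Z_nabla[OF G], of i]
            supported_Z_nabla[OF supported_theta_deriv[OF G, of i]] supported_op_act_S[OF G assms(2)]
          unfolding supported_def by simp
      qed
    qed
    show "op_act 1 (S i) (nab G) = nab (op_act 1 (S i) G)"
    proof (intro ext)
      fix n I
      show "op_act 1 (S i) (nab G) n I = nab (op_act 1 (S i) G) n I"
      proof (cases "I \<subseteq> {1..N}")
        case True
        then show ?thesis using assms(2) by (intro op_act_S_Z_nabla) (auto intro: finite_subset)
      next
        case False
        then show ?thesis
          using supported_op_act_S[OF supported_Z_nabla[OF G] assms(2)]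
            supported_Z_nabla[OF supported_op_act_S[OF G assms(2)]]
          unfolding supported_def by simp
      qed
    qed
  qed
  have "theta_deriv i (expn F) n I =
      (\<Sum>k\<le>Suc M. scale (1 / fact k) (theta_deriv i ((nab ^^ k) F) n I))"
    unfolding theta_deriv_def exp_Z_nabla_eq_sum[OF assms(1) M(2)]
    by (simp add: signed_sum scale_signed signed_add)
  also have "\<dots> = (\<Sum>k\<le>Suc M. scale (1 / fact k) ((nab ^^ k) (theta_deriv i F) n I)) +
      (\<Sum>k\<le>M. scale (1 / fact k) (op_act 1 (S i) ((nab ^^ k) F) n I))"
    using super_taylor_supported[OF assms(1)]
    by (rule exp_sum_commutator) (rule comm, assumption)+
  also have "(\<Sum>k\<le>M. scale (1 / fact k) (op_act 1 (S i) ((nab ^^ k) F) n I)) =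
      op_act 1 (S i) (expn F) n I"
    unfolding op_act_def exp_Z_nabla_eq_sum[OF assms(1) M(1)]
    using assms(2) by (simp only: S_sum S_scale scale_signed signed_sum)
  finally show ?thesis
    unfolding exp_Z_nabla_eq_sum[OF F' M(2)] .
qed

section \<open>Translation covariant series in two variables\<close>

text \<open>
  In the equation for \<open>S i\<close> the sign on the left comes from moving $S^i$ past
  $Z^{m|I} W^{n|J}$, the one on the right from moving $\partial_{\zeta^i}$ past $Z^{m|I}$.
\<close>

definition translation_covariant :: "'v superseries2 \<Rightarrow> bool" where
  "translation_covariant H \<longleftrightarrow>
     (\<forall>m I n J. m < 0 \<or> n < 0 \<or> \<not> I \<subseteq> {1..N} \<or> \<not> J \<subseteq> {1..N} \<longrightarrow> H m I n J = 0) \<and>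
     (\<forall>m I n J. T (H m I n J) =
        z_deriv scale (\<lambda>m I. H m I n J) m I + z_deriv scale (H m I) n J) \<and>
     (\<forall>i\<in>{1..N}. \<forall>m I n J. I \<subseteq> {1..N} \<longrightarrow> J \<subseteq> {1..N} \<longrightarrow>
        signed (card I + card J) (S i (H m I n J)) =
        theta_deriv i (\<lambda>m I. H m I n J) m I + signed (card I) (theta_deriv i (H m I) n J))"

lemma
  assumes "translation_covariant H"
  shows translation_covariant_eq_0:
      "m < 0 \<or> n < 0 \<or> \<not> I \<subseteq> {1..N} \<or> \<not> J \<subseteq> {1..N} \<Longrightarrow> H m I n J = 0"
    and translation_covariant_T:
      "T (H m I n J) = z_deriv scale (\<lambda>m I. H m I n J) m I + z_deriv scale (H m I) n J"
    and translation_covariant_S: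
      "i \<in> {1..N} \<Longrightarrow> I \<subseteq> {1..N} \<Longrightarrow> J \<subseteq> {1..N} \<Longrightarrow>
        signed (card I + card J) (S i (H m I n J)) =
        theta_deriv i (\<lambda>m I. H m I n J) m I + signed (card I) (theta_deriv i (H m I) n J)"
proof -
  note * = assms[unfolded translation_covariant_def]
  show "m < 0 \<or> n < 0 \<or> \<not> I \<subseteq> {1..N} \<or> \<not> J \<subseteq> {1..N} \<Longrightarrow> H m I n J = 0"
    by (rule *[THEN conjunct1, rule_format])
  show "T (H m I n J) = z_deriv scale (\<lambda>m I. H m I n J) m I + z_deriv scale (H m I) n J"
    by (rule *[THEN conjunct2, THEN conjunct1, rule_format])
  show "i \<in> {1..N} \<Longrightarrow> I \<subseteq> {1..N} \<Longrightarrow> J \<subseteq> {1..N} \<Longrightarrow>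
        signed (card I + card J) (S i (H m I n J)) =
        theta_deriv i (\<lambda>m I. H m I n J) m I + signed (card I) (theta_deriv i (H m I) n J)"
    by (rule *[THEN conjunct2, THEN conjunct2, rule_format])
qed

lemma translation_covariantI:
  assumes "\<And>m I n J. m < 0 \<or> n < 0 \<or> \<not> I \<subseteq> {1..N} \<or> \<not> J \<subseteq> {1..N} \<Longrightarrow> H m I n J = 0"
    and "\<And>m I n J. T (H m I n J) =
      z_deriv scale (\<lambda>m I. H m I n J) m I + z_deriv scale (H m I) n J"
    and "\<And>i m I n J. i \<in> {1..N} \<Longrightarrow> I \<subseteq> {1..N} \<Longrightarrow> J \<subseteq> {1..N} \<Longrightarrow>
      signed (card I + card J) (S i (H m I n J)) =
      theta_deriv i (\<lambda>m I. H m I n J) m I + signed (card I) (theta_deriv i (H m I) n J)"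
  shows "translation_covariant H"
  unfolding translation_covariant_def
  by (intro conjI allI impI ballI) (fact assms(1), fact assms(2), fact assms(3))

text \<open>The w-derivative commutes with T, S^i and all derivatives in the equations. This closure
  and the next one feed the induction over covariant series.\<close>

lemma translation_covariant_z_deriv:
  assumes "translation_covariant H"
  shows "translation_covariant (\<lambda>m I. z_deriv scale (H m I))"
proof -
  have "z_deriv scale (H m I) n J = 0" if "m < 0 \<or> n < 0 \<or> \<not> I \<subseteq> {1..N} \<or> \<not> J \<subseteq> {1..N}" for m I n J
    using that translation_covariant_eq_0[OF assms(1), of m "n + 1" I J] by (cases "n = -1") (auto simp: z_deriv_def)
  moreover have "T (z_deriv scale (H m I) n J) =
      z_deriv scale (\<lambda>m I. z_deriv scale (H m I) n J) m I + z_deriv scale (z_deriv scale (H m I)) n J"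
    for m I n J
    using translation_covariant_T[OF assms(1), of m I "n + 1" J]
    by (simp add: z_deriv_def T.scale scale_right_distrib mult.commute)
  moreover have "signed (card I + card J) (S i (z_deriv scale (H m I) n J)) =
      theta_deriv i (\<lambda>m I. z_deriv scale (H m I) n J) m I +
        signed (card I) (theta_deriv i (z_deriv scale (H m I)) n J)"
    if "i \<in> {1..N}" "I \<subseteq> {1..N}" "J \<subseteq> {1..N}" for i m I n J
    using arg_cong[OF translation_covariant_S[OF assms(1) that, of m "n + 1"], of "scale (of_int (n + 1))"] that(1)
    by (auto simp: z_deriv_def theta_deriv_def S_scale scale_right_distrib scale_signed)
  ultimately show ?thesis by (rule translation_covariantI)
qed

text \<open>The series is the zeta^j-derivative of \<open>H\<close>, with the sign for passing
  Z^{m|I}. It anticommutes with S^i and with both odd derivatives, so all three terms of the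
  equation acquire the same factor, which appears below as
  \<open>- signed (card I + c)\<close>.\<close>

lemma translation_covariant_theta_deriv:
  assumes "translation_covariant H" "j \<in> {1..N}"
  shows "translation_covariant (\<lambda>m I n J. signed (card I) (theta_deriv j (H m I) n J))"
    (is "translation_covariant ?K")
proof -
  have "?K m I n J = 0" if "m < 0 \<or> n < 0 \<or> \<not> I \<subseteq> {1..N} \<or> \<not> J \<subseteq> {1..N}" for m I n J
    using that translation_covariant_eq_0[OF assms(1), of m n I "insert j J"] by (auto simp: theta_deriv_def)
  moreover have "T (?K m I n J) =
      z_deriv scale (\<lambda>m I. ?K m I n J) m I + z_deriv scale (?K m I) n J"
    for m I n J
    using translation_covariant_T[OF assms(1), of m I n "insert j J"]
    by (simp add: z_deriv_def theta_deriv_def linear_signed[OF linear_T] scale_signed signed_add T.zero)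
  moreover have "signed (card I + card J) (S i (?K m I n J)) =
      theta_deriv i (\<lambda>m I. ?K m I n J) m I + signed (card I) (theta_deriv i (?K m I) n J)"
    if i: "i \<in> {1..N}" and I: "I \<subseteq> {1..N}" and J: "J \<subseteq> {1..N}" for i m I n J
  proof (cases "j \<in> J")
    case True
    then show ?thesis using i by (simp add: theta_deriv_def S_zero)
  next
    case False
    define c where "c = card {k \<in> J. k < j}"
    have fin: "finite I" "finite J" using I J by (auto intro: finite_subset)
    have "signed (card I + card (insert j J)) (S i (H m I n (insert j J))) =
      theta_deriv i (\<lambda>m I. H m I n (insert j J)) m I +
        signed (card I) (theta_deriv i (H m I) n (insert j J))"
      by (intro translation_covariant_S) (use assms i I J in auto)
    then have "signed (card I + c) (signed (card I + card (insert j J)) (S i (H m I n (insert j J)))) =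
      signed (card I + c) (theta_deriv i (\<lambda>m I. H m I n (insert j J)) m I) +
        signed (card I + c) (signed (card I) (theta_deriv i (H m I) n (insert j J)))"
      by (simp only: signed_add)
    moreover have "signed (card I + card J) (S i (?K m I n J)) =
        - signed (card I + c) (signed (card I + card (insert j J)) (S i (H m I n (insert j J))))"
      using False fin i
      by (simp add: theta_deriv_def S_signed flip: c_def) (simp add: signed_def)
    moreover have "theta_deriv i (\<lambda>m I. ?K m I n J) m I =
        - signed (card I + c) (theta_deriv i (\<lambda>m I. H m I n (insert j J)) m I)"
      using False fin
      by (simp add: theta_deriv_def flip: c_def) (simp add: signed_def)
    moreover have "signed (card I) (theta_deriv i (?K m I) n J) =
        - signed (card I + c) (signed (card I) (theta_deriv i (H m I) n (insert j J)))"
    proof -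
      have "signed (card I) (theta_deriv i (?K m I) n J) = theta_deriv i (theta_deriv j (H m I)) n J"
        unfolding theta_deriv_signed by (simp add: signed_def)
      also have "\<dots> = - signed c (theta_deriv i (H m I) n (insert j J))"
        using False unfolding theta_deriv_anticommute[of i j]
        by (simp add: theta_deriv_def[of j] c_def)
      finally show ?thesis by (simp add: signed_def)
    qed
    ultimately show ?thesis by simp
  qed
  ultimately show ?thesis by (rule translation_covariantI)
qed

text \<open>Chain rule for the substitution of -Z. The minus sign is written as
  \<open>signed 1\<close> so that \<open>exp_Z_nabla_signed\<close> can move it out of the
  exponential.\<close>

lemma z_deriv_neg_Z: "z_deriv scale (neg_Z F) = (\<lambda>n I. signed (1::nat) (neg_Z (z_deriv scale F) n I))"
  by (auto simp: z_deriv_def neg_Z_def signed_def fun_eq_iff)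

lemma theta_deriv_neg_Z:
  assumes "supported N F"
  shows "theta_deriv i (neg_Z F) = (\<lambda>n I. signed (1::nat) (neg_Z (theta_deriv i F) n I))"
proof (intro ext)
  fix n I
  show "theta_deriv i (neg_Z F) n I = signed (1::nat) (neg_Z (theta_deriv i F) n I)"
  proof (cases "I \<subseteq> {1..N}")
    case True
    then have "finite I" by (rule finite_subset) simp
    then show ?thesis by (simp add: theta_deriv_def neg_Z_def) (simp add: signed_def)
  next
    case False
    then show ?thesis using assms by (simp add: theta_deriv_def neg_Z_def supported_def)
  qed
qed

text \<open>This is H(Z,0) = e^{Z nabla} H(0,-Z). With \<open>H\<close> generalized, the induction
  hypothesis applies one degree lower both to \<open>H\<close> and to its W-derivative, the two
  series on the right of the differential equation.\<close>

lemma translation_covariant_restrict: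
  assumes "translation_covariant H"
  shows "H n I 0 {} = expn (neg_Z (H 0 {})) n I"
proof (cases "n \<ge> 0 \<and> I \<subseteq> {1..N}")
  case True
  then have "finite I" by (auto intro: finite_subset)
  then show ?thesis using assms True
  proof (induction "nat n + card I" arbitrary: n I H rule: less_induct)
    case less
    have taylor: "super_taylor N (K 0 {})" "super_taylor N (neg_Z (K 0 {}))"
      if "translation_covariant K" for K
    proof -
      show "super_taylor N (K 0 {})"
        using translation_covariant_eq_0[OF that] by (simp add: super_taylor_def)
      then show "super_taylor N (neg_Z (K 0 {}))" by (rule super_taylor_neg_Z)
    qed
    note H = taylor[OF less.prems(2)]
    show ?case
    proof (cases "n > 0")
      case True
      let ?K = "\<lambda>m I. z_deriv scale (H m I)"
      have K: "translation_covariant ?K"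
        by (rule translation_covariant_z_deriv) fact
      have IH: "L (n - 1) I 0 {} = expn (neg_Z (L 0 {})) (n - 1) I" if "translation_covariant L" for L
        using less.prems True that by (intro less.hyps) auto
      have "scale (of_int n) (H n I 0 {}) = T (H (n - 1) I 0 {}) - ?K (n - 1) I 0 {}"
        using translation_covariant_T[OF less.prems(2), of "n - 1" I 0 "{}"] by (simp add: z_deriv_def)
      also have "\<dots> = T (expn (neg_Z (H 0 {})) (n - 1) I) - expn (neg_Z (?K 0 {})) (n - 1) I"
        using IH[OF less.prems(2)] IH[OF K] by simp
      \<comment> \<open>The subtracted term is what differentiating \<open>neg_Z (H 0 {})\<close>
        yields, by the chain rule for -Z.\<close>
      also have "\<dots> = z_deriv scale (expn (neg_Z (H 0 {}))) (n - 1) I"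
        unfolding z_deriv_exp_Z_nabla[OF H(2)] z_deriv_neg_Z exp_Z_nabla_signed[OF taylor(2)[OF K]]
        by (simp add: signed_def)
      also have "\<dots> = scale (of_int n) (expn (neg_Z (H 0 {})) n I)"
        by (simp add: z_deriv_def)
      finally show ?thesis using True by simp
    next
      case False
      then have n: "n = 0" using less.prems by simp
      show ?thesis
      proof (cases "I = {}")
        case True
        then show ?thesis using n exp_Z_nabla_at_0[OF H(2)] by (simp add: neg_Z_def signed_def)
      next
        case False
        then obtain i where i: "i \<in> I" by blast
        define I' where "I' = I - {i}"
        have I': "i \<notin> I'" "I = insert i I'" "finite I'" "I' \<subseteq> {1..N}" "i \<in> {1..N}"
          using i less.prems by (auto simp: I'_def)
        let ?K = "\<lambda>m I n J. signed (card I) (theta_deriv i (H m I) n J)"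
        have K: "translation_covariant ?K"
          by (rule translation_covariant_theta_deriv) fact+
        \<comment> \<open>No sign remains at the empty index set, so setting Z = 0 commutes with the
          zeta^i-derivative.\<close>
        have K0: "?K 0 {} = theta_deriv i (H 0 {})"
          by (simp add: signed_def)
        have IH: "L n I' 0 {} = expn (neg_Z (L 0 {})) n I'" if "translation_covariant L" for L
          using less.prems I' that by (intro less.hyps) auto
        have "theta_deriv i (\<lambda>m I. H m I 0 {}) n I' =
            signed (card I') (S i (H n I' 0 {})) - ?K n I' 0 {}"
          using translation_covariant_S[OF less.prems(2) I'(5,4), of "{}" n 0]
          by (simp add: algebra_simps)
        also have "\<dots> = op_act 1 (S i) (expn (neg_Z (H 0 {}))) n I' - expn (neg_Z (?K 0 {})) n I'"
          using IH[OF less.prems(2)] IH[OF K] by (simp add: op_act_def)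
        also have "\<dots> = theta_deriv i (expn (neg_Z (H 0 {}))) n I'"
          unfolding theta_deriv_exp_Z_nabla[OF H(2) I'(5)]
            theta_deriv_neg_Z[OF super_taylor_supported[OF H(1)]]
            exp_Z_nabla_signed[OF taylor(2)[OF K, unfolded K0]] K0
          by (simp add: signed_def)
        finally show ?thesis using I'(1)
          by (auto simp: theta_deriv_def signed_def I'(2) split: if_splits)
      qed
    qed
  qed
next
  case False
  have "super_taylor N (H 0 {})"
    using translation_covariant_eq_0[OF assms] by (simp add: super_taylor_def)
  then have "super_taylor N (expn (neg_Z (H 0 {})))"
    by (intro super_taylor_exp_Z_nabla super_taylor_neg_Z)
  moreover have "H n I 0 {} = 0"
    using False by (intro translation_covariant_eq_0[OF assms]) auto
  ultimately show ?thesis using False by (auto simp: super_taylor_def)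
qed

text \<open>The sum of the z- and w-derivatives annihilates z - w. Vanishing at negative exponents
  is not part of the statement, because the product of two fields may have negative powers of z
  before the multiplication.\<close>

lemma zw_mult_power_T:
  assumes "\<And>m I n J. T (H m I n J) =
    z_deriv scale (\<lambda>m I. H m I n J) m I + z_deriv scale (H m I) n J"
  shows "T ((zw_mult ^^ k) H m I n J) =
    z_deriv scale (\<lambda>m I. (zw_mult ^^ k) H m I n J) m I + z_deriv scale ((zw_mult ^^ k) H m I) n J"
proof (induction k arbitrary: m I n J)
  case 0
  show ?case using assms by simp
next
  case (Suc k)
  define K where "K = (zw_mult ^^ k) H"
  have K: "T (K m I n J) = scale (of_int (m + 1)) (K (m + 1) I n J) +
      scale (of_int (n + 1)) (K m I (n + 1) J)" for m n
    using Suc[of m I n J] by (simp add: K_def z_deriv_def)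
  have "T (zw_mult K m I n J) =
      scale (of_int (m + 1)) (zw_mult K (m + 1) I n J) +
      scale (of_int (n + 1)) (zw_mult K m I (n + 1) J)"
    using K[of "m - 1" n] K[of m "n - 1"]
    by (simp add: zw_mult_def T.diff scale_right_diff_distrib scale_left_distrib algebra_simps)
  then show ?case by (simp add: K_def z_deriv_def)
qed

lemma zw_mult_power_S:
  assumes "\<And>m n I J. I \<subseteq> {1..N} \<Longrightarrow> J \<subseteq> {1..N} \<Longrightarrow> signed (card I + card J) (S i (H m I n J)) =
      theta_deriv i (\<lambda>m I. H m I n J) m I + signed (card I) (theta_deriv i (H m I) n J)"
    and "i \<in> {1..N}" "I \<subseteq> {1..N}" "J \<subseteq> {1..N}"
  shows "signed (card I + card J) (S i ((zw_mult ^^ k) H m I n J)) =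
      theta_deriv i (\<lambda>m I. (zw_mult ^^ k) H m I n J) m I +
      signed (card I) (theta_deriv i ((zw_mult ^^ k) H m I) n J)"
proof (induction k arbitrary: m n)
  case 0
  show ?case using assms by simp
next
  case (Suc k)
  define K where "K = (zw_mult ^^ k) H"
  have S_diff: "S i (x - y) = S i x - S i y" for x y
    using S_add[OF assms(2), of "x - y" y] by (simp add: algebra_simps)
  have K: "signed (card I + card J) (S i (K m I n J)) =
      theta_deriv i (\<lambda>m I. K m I n J) m I + signed (card I) (theta_deriv i (K m I) n J)" for m n
    using Suc by (simp add: K_def)
  have "theta_deriv i (\<lambda>m I. zw_mult K m I n J) m I =
      theta_deriv i (\<lambda>m I. K m I n J) (m - 1) I - theta_deriv i (\<lambda>m I. K m I (n - 1) J) m I"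
    by (simp add: theta_deriv_def zw_mult_def signed_diff)
  moreover have "theta_deriv i (zw_mult K m I) n J =
      theta_deriv i (K (m - 1) I) n J - theta_deriv i (K m I) (n - 1) J"
    by (simp add: theta_deriv_def zw_mult_def signed_diff)
  moreover have "signed (card I + card J) (S i (zw_mult K m I n J)) =
      signed (card I + card J) (S i (K (m - 1) I n J)) -
      signed (card I + card J) (S i (K m I (n - 1) J))"
    by (simp add: zw_mult_def S_diff signed_diff)
  ultimately have "signed (card I + card J) (S i (zw_mult K m I n J)) =
      theta_deriv i (\<lambda>m I. zw_mult K m I n J) m I +
      signed (card I) (theta_deriv i (zw_mult K m I) n J)"
    by (simp only: K signed_diff add_diff_add)
  then show ?case by (simp add: K_def)
qed

end

section \<open>Skew-symmetry\<close>

context NW_SUSY_vertex_algebra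
begin

section \<open>The axioms in coefficients\<close>

lemma linear_Y: "Vector_Spaces.linear scale scale (Y a n I)"
  using Y_field[of a] by (simp add: End_field_def)

lemma Y_zero: "Y a n I 0 = 0"
proof -
  interpret Vector_Spaces.linear scale scale "Y a n I" by (rule linear_Y)
  show ?thesis by (rule zero)
qed

lemma Y_eq_0: "\<not> I \<subseteq> {1..N} \<Longrightarrow> Y a n I v = 0"
  using Y_field[of a] by (simp add: End_field_def super_laurent_def field_apply_def)

lemma Y_vac_eq_0: "n < 0 \<Longrightarrow> Y a n I vac = 0"
  using Y_vac[of a] by (simp add: super_taylor_def field_apply_def)

lemma Y_vac_0: "Y a 0 {} vac = a"
  using Y_vac_at_0[of a] by (simp add: field_apply_def)

lemma T_Y:
  assumes "a \<in> parity_part V0 V1 p"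
  shows "T (Y a n I v) = Y a n I (T v) + scale (of_int (n + 1)) (Y a (n + 1) I v)"
  using fun_cong[OF fun_cong[OF T_bracket[OF assms, of v]], of n I]
  by (simp add: op_bracket_def op_act_def field_apply_def z_deriv_def signed_def algebra_simps)

lemma S_Y:
  assumes "a \<in> parity_part V0 V1 p" "i \<in> {1..N}"
  shows "signed (card I) (S i (Y a n I v)) =
    signed p (Y a n I (S i v)) + theta_deriv i (\<lambda>n I. Y a n I v) n I"
  using fun_cong[OF fun_cong[OF S_bracket[OF assms, of v]], of n I]
  by (simp add: op_bracket_def op_act_def field_apply_def[abs_def] algebra_simps)

lemma T_Y_vac:
  assumes "a \<in> parity_part V0 V1 p"
  shows "T (Y a n I vac) = scale (of_int (n + 1)) (Y a (n + 1) I vac)"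
  using T_Y[OF assms, of n I vac] by (simp add: T_vac Y_zero)

lemma S_Y_vac:
  assumes "a \<in> parity_part V0 V1 p" "i \<in> {1..N}"
  shows "signed (card I) (S i (Y a n I vac)) = theta_deriv i (\<lambda>n I. Y a n I vac) n I"
  using S_Y[OF assms, of I n vac] assms(2) by (simp add: S_vac Y_zero)

text \<open>The bracket axioms speak of homogeneous vectors; identities linear in the vector extend
  to all vectors by this splitting.\<close>

lemma homogeneous_decomposition:
  obtains x y where "x \<in> parity_part V0 V1 0" "y \<in> parity_part V0 V1 1" "v = x + y"
  using even_plus_odd[of v] by (auto simp: parity_part_def)

text \<open>On Y(a,Z)|0> the operators T and S^i act as derivatives, and its constant term is a.
  Hence the commutation rules of the derivatives, read at low coefficients, become rules for T and
  S^i applied to a.\<close>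

sublocale nabla_operators scale N T S
proof (rule nabla_operators.intro[OF vector_space_axioms], rule nabla_operators_axioms.intro)
  have lin_S: "Vector_Spaces.linear scale scale (S i)" if "i \<in> {1..N}" for i
    using S_odd[OF that] by (simp add: parity_op_def)
  show "Vector_Spaces.linear scale scale T"
    using T_even by (simp add: parity_op_def)
  then interpret T: Vector_Spaces.linear scale scale T .
  have S_eq: "S i a = Y a 0 {i} vac" if "a \<in> parity_part V0 V1 p" "i \<in> {1..N}" for a p i
    using S_Y_vac[OF that, of "{}" 0] by (simp add: theta_deriv_def Y_vac_0 signed_def)
  show "Vector_Spaces.linear scale scale (S i)" if "i \<in> {1..N}" for i
    using that by (rule lin_S)
  show "S i (T v) = T (S i v)" if i: "i \<in> {1..N}" for i v
  proof -
    interpret S: Vector_Spaces.linear scale scale "S i" using i by (rule lin_S)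
    have *: "S i (T a) = T (S i a)" if a: "a \<in> parity_part V0 V1 p" for a p
    proof -
      have "T a = Y a 1 {} vac"
        using T_Y_vac[OF a, of 0 "{}"] by (simp add: Y_vac_0)
      then have "S i (T a) = Y a 1 {i} vac"
        using S_Y_vac[OF a i, of "{}" 1] by (simp add: theta_deriv_def signed_def)
      moreover have "T (S i a) = Y a 1 {i} vac"
        using T_Y_vac[OF a, of 0 "{i}"] by (simp add: S_eq[OF a i])
      ultimately show ?thesis by simp
    qed
    obtain x y where "x \<in> parity_part V0 V1 0" "y \<in> parity_part V0 V1 1" "v = x + y"
      by (rule homogeneous_decomposition)
    then show ?thesis by (simp add: S.add T.add *)
  qed
  show "S i (S j v) = - S j (S i v)" if i: "i \<in> {1..N}" and j: "j \<in> {1..N}" for i j v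
  proof -
    interpret S: Vector_Spaces.linear scale scale "S i" using i by (rule lin_S)
    interpret S': Vector_Spaces.linear scale scale "S j" using j by (rule lin_S)
    have *: "S i (S j a) = - S j (S i a)" if a: "a \<in> parity_part V0 V1 p" for a p
    proof -
      let ?F = "\<lambda>n I. Y a n I vac"
      \<comment> \<open>\<open>S l a\<close> is the theta^l-coefficient of \<open>?F\<close>; the
        minus sign comes from moving S^k past theta^l.\<close>
      have **: "S k (S l a) = - theta_deriv l (theta_deriv k ?F) 0 {}"
        if k: "k \<in> {1..N}" and l: "l \<in> {1..N}" for k l
        using S_Y_vac[OF a k, of "{l}" 0] unfolding S_eq[OF a l]
        by (simp add: theta_deriv_def[of l] signed_def minus_equation_iff[of "S k _"])
      show ?thesis
        unfolding **[OF i j] **[OF j i] theta_deriv_anticommute[of j i] ..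
    qed
    obtain x y where xy: "x \<in> parity_part V0 V1 0" "y \<in> parity_part V0 V1 1" "v = x + y"
      by (rule homogeneous_decomposition)
    show ?thesis by (simp add: xy(3) S.add S'.add *[OF xy(1)] *[OF xy(2)])
  qed
qed

text \<open>T acts on the two fields as a derivation and kills the vacuum. Covariance is checked on
  this order of the product alone: by locality the other order has the same multiple by (z-w)^k and
  supplies regularity in z.\<close>

lemma product_ZW_T:
  assumes "a \<in> parity_part V0 V1 p" "b \<in> parity_part V0 V1 q"
  shows "T (product_ZW p (Y a) (Y b) vac m I n J) =
    z_deriv scale (\<lambda>m I. product_ZW p (Y a) (Y b) vac m I n J) m I +
    z_deriv scale (product_ZW p (Y a) (Y b) vac m I) n J"
proof -
  interpret Y: Vector_Spaces.linear scale scale "Y a m I" by (rule linear_Y)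
  show ?thesis
    by (simp add: product_ZW_def z_deriv_def linear_signed[OF linear_T] T_Y[OF assms(1)]
        T_Y_vac[OF assms(2)] Y.scale signed_add scale_signed add.commute)
qed

lemma product_ZW_S:
  assumes a: "a \<in> parity_part V0 V1 p" and b: "b \<in> parity_part V0 V1 q"
    and i: "i \<in> {1..N}" and IJ: "I \<subseteq> {1..N}" "J \<subseteq> {1..N}"
  shows "signed (card I + card J) (S i (product_ZW p (Y a) (Y b) vac m I n J)) =
    theta_deriv i (\<lambda>m I. product_ZW p (Y a) (Y b) vac m I n J) m I +
    signed (card I) (theta_deriv i (product_ZW p (Y a) (Y b) vac m I) n J)"
proof -
  let ?P = "product_ZW p (Y a) (Y b) vac"
  \<comment> \<open>The sign left over once \<open>signed (card I)\<close> is set aside for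
    \<open>S_Y\<close>: that of moving S^i past W^{n|J} together with that of the product.\<close>
  define e where "e = card J + (p + card I) * card J"
  have fin: "finite I" "finite J" using IJ by (auto intro: finite_subset)
  have "signed (card I + card J) (S i (?P m I n J)) =
      signed e (signed (card I) (S i (Y a m I (Y b n J vac))))"
    unfolding product_ZW_def e_def by (simp only: S_signed[OF i] signed_signed ac_simps)
  also have "\<dots> = signed e (signed p (Y a m I (S i (Y b n J vac)))) +
      signed e (theta_deriv i (\<lambda>m I. Y a m I (Y b n J vac)) m I)"
    unfolding S_Y[OF a i] signed_add ..
  also have "S i (Y b n J vac) = signed (card J) (theta_deriv i (\<lambda>n J. Y b n J vac) n J)"
    unfolding S_Y_vac[OF b i, symmetric] by (simp add: signed_def)
  also have "signed e (signed p (Y a m I (signed (card J) (theta_deriv i (\<lambda>n J. Y b n J vac) n J)))) =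
      signed (card I) (theta_deriv i (?P m I) n J)"
    using fin
    by (simp add: product_ZW_def theta_deriv_def linear_signed[OF linear_Y] Y_zero e_def)
      (simp add: signed_def)
  also have "signed e (theta_deriv i (\<lambda>m I. Y a m I (Y b n J vac)) m I) =
      theta_deriv i (\<lambda>m I. ?P m I n J) m I"
    using fin by (simp add: product_ZW_def theta_deriv_def e_def) (auto simp: signed_def)
  finally show ?thesis by (simp only: add.commute)
qed

lemma skew_symmetry:
  assumes a: "a \<in> parity_part V0 V1 p" and b: "b \<in> parity_part V0 V1 q"
  shows "Y a n I b = signed (p * q) (expn (neg_Z (field_apply (Y b) a)) n I)"
proof -
  \<comment> \<open>Evaluating at the vacuum makes \<open>P\<close> regular in w and
    \<open>Q\<close> regular in z.\<close>
  define P where "P = product_ZW p (Y a) (Y b) vac"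
  define Q where "Q = (\<lambda>m I n J. signed (p * q) (product_WZ q (Y b) (Y a) vac m I n J))"
  obtain k where k: "(zw_mult ^^ k) (field_bracket p q (Y a) (Y b) vac) = (\<lambda>m I n J. 0)"
    using locality[OF a b] by blast
  have bracket: "field_bracket p q (Y a) (Y b) vac = (\<lambda>m I n J. P m I n J - Q m I n J)"
    by (simp add: field_bracket_def P_def Q_def)
  define H where "H = (zw_mult ^^ k) P"
  have HQ: "H m I n J = (zw_mult ^^ k) Q m I n J" for m I n J
    using zw_mult_power_diff[of k P Q m I n J] k by (simp add: H_def bracket)
  have P0: "P m I n J = 0" if "n < 0 \<or> \<not> I \<subseteq> {1..N} \<or> \<not> J \<subseteq> {1..N}" for m I n J
    using that by (elim disjE) (simp_all add: P_def product_ZW_def Y_vac_eq_0 Y_eq_0 Y_zero)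
  have Q0: "Q m I n J = 0" if "m < 0" for m I n J
    using that by (simp add: Q_def product_WZ_def Y_vac_eq_0 Y_zero)
  have H: "translation_covariant H"
  proof (rule translation_covariantI)
    show "H m I n J = 0" if "m < 0 \<or> n < 0 \<or> \<not> I \<subseteq> {1..N} \<or> \<not> J \<subseteq> {1..N}" for m I n J
    proof (cases "m < 0")
      case True
      then show ?thesis unfolding HQ by (intro zw_mult_power_z_taylor Q0)
    next
      case False
      then show ?thesis
        using that unfolding H_def
        by (metis P0 zw_mult_power_eq_0 zw_mult_power_w_taylor(1))
    qed
    show "T (H m I n J) = z_deriv scale (\<lambda>m I. H m I n J) m I + z_deriv scale (H m I) n J"
      for m I n J
      unfolding H_def P_def by (rule zw_mult_power_T) (rule product_ZW_T[OF a b])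
    show "signed (card I + card J) (S i (H m I n J)) =
        theta_deriv i (\<lambda>m I. H m I n J) m I + signed (card I) (theta_deriv i (H m I) n J)"
      if "i \<in> {1..N}" "I \<subseteq> {1..N}" "J \<subseteq> {1..N}" for i m I n J
      unfolding H_def P_def using that
      by (intro zw_mult_power_S product_ZW_S[OF a b])
  qed
  define G where "G = neg_Z (field_apply (Y b) a)"
  have "super_taylor N (H 0 {})"
    using translation_covariant_eq_0[OF H] by (simp add: super_taylor_def)
  note taylor = super_taylor_neg_Z[OF this]
  have "H 0 {} n J = signed k (signed (p * q) (Y b (n - int k) J a))" for n J
  proof -
    have "H 0 {} n J = signed k (Q 0 {} (n - int k) J)"
      unfolding HQ by (rule zw_mult_power_z_taylor(2)) (rule Q0)
    then show ?thesis by (simp add: Q_def product_WZ_def Y_vac_0 signed_def)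
  qed
  \<comment> \<open>The sign of (-w)^k cancels against the difference of \<open>neg_Z\<close> at the
    exponents \<open>n\<close> and \<open>n - int k\<close>.\<close>
  then have "(\<lambda>n I. signed (p * q) (neg_Z (H 0 {}) n I)) = (z_mult ^^ k) G"
    by (auto simp: neg_Z_def G_def fun_eq_iff z_mult_power field_apply_def signed_def)
  then have G: "signed (p * q) (expn (neg_Z (H 0 {})) n I) = expn ((z_mult ^^ k) G) n I" for n I
    using exp_Z_nabla_signed[OF taylor, of "p * q" n I] by simp
  have "expn ((z_mult ^^ k) G) = (z_mult ^^ k) (expn G)"
    by (induction k) (simp_all add: exp_Z_nabla_z_mult)
  \<comment> \<open>Cancelling z^k amounts to reading coefficients at \<open>n + int k\<close>; at w
    = 0 the factor z^k in \<open>H\<close> undoes this shift.\<close>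
  then have "expn G n I = signed (p * q) (expn (neg_Z (H 0 {})) (n + int k) I)"
    by (simp add: G z_mult_power)
  also have "expn (neg_Z (H 0 {})) (n + int k) I = H (n + int k) I 0 {}"
    using translation_covariant_restrict[OF H] by simp
  also have "\<dots> = P n I 0 {}"
    unfolding H_def using P0 by (subst zw_mult_power_w_taylor(2)) auto
  also have "\<dots> = Y a n I b"
    by (simp add: P_def product_ZW_def Y_vac_0 signed_def)
  finally show ?thesis by (simp add: G_def signed_def)
qed

end

theorem theorem3p3p14:
  fixes scale :: "complex \<Rightarrow> 'v::ab_group_add \<Rightarrow> 'v"
    and V0 V1 :: "'v set" and N :: nat and vac :: 'v
    and T :: "'v \<Rightarrow> 'v" and S :: "nat \<Rightarrow> 'v \<Rightarrow> 'v"
    and Y :: "'v \<Rightarrow> ('v \<Rightarrow> 'v) superseries"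
    and a b :: 'v and p q :: nat
  assumes "NW_SUSY_vertex_algebra scale V0 V1 N vac T S Y"
    and "a \<in> parity_part V0 V1 p"
    and "b \<in> parity_part V0 V1 q"
  shows "field_apply (Y a) b =
    (\<lambda>n I. signed (p * q) (exp_Z_nabla scale N T S (neg_Z (field_apply (Y b) a)) n I))"
proof (intro ext)
  fix n I
  interpret NW_SUSY_vertex_algebra scale V0 V1 N vac T S Y by fact
  show "field_apply (Y a) b n I =
      signed (p * q) (exp_Z_nabla scale N T S (neg_Z (field_apply (Y b) a)) n I)"
    unfolding field_apply_def[of "Y a"] using assms(2,3) by (rule skew_symmetry)
qed

end
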